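(* Let $\tilde\Pi$ be a global regular in-plane parametrisation of a planar quadrilateral mesh and let $\bar\Psi$ be a piecewise parametric $3D$ function agreeing with $\tilde\Pi$. Let two adjacent mesh elements be parametrised by the unit square so that their common edge is $u=1$ for the left element and $u=0$ for the right element, and let $\bar L=(\tilde L,L)$ and $\bar R=(\tilde R,R)$ be the restrictions of $\bar\Psi$ to the left and right element, with $\bar L(1,v)=\bar R(0,v)$ for all $v\in[0,1]$. Then $\bar L$ and $\bar R$ join $G^1$-smoothly along the common edge if and only if $$L_u(1,v)\,l(v)+R_u(0,v)\,r(v)+L_v(1,v)\,c(v)=0\qquad\text{for all }v\in[0,1],$$ where $L_u,R_u,L_v$ are the partial derivatives of the $Z$-components and $$c(v)=\langle \tilde L_u(1,v),\tilde R_u(0,v)\rangle,\quad l(v)=\langle \tilde R_u(0,v),\tilde L_v(1,v)\rangle,\quad r(v)=-\langle \tilde L_u(1,v),\tilde L_v(1,v)\rangle .$$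
   Context: A planar simply-connected domain in the $XY$-plane is subdivided into a mesh of (convex) quadrilateral elements with pairwise disjoint interiors, any two elements being disjoint or meeting in a common vertex or a common edge. For planar vectors, $\langle \tilde a,\tilde b\rangle=a_Xb_Y-a_Yb_X$; for $3D$ vectors, $\langle\bar a,\bar b\rangle$ is the cross product. A $3D$ map is written $\bar P=(\tilde P,P)$ with $\tilde P=(P_X,P_Y)$ its $XY$-part and $P$ its $Z$-component. A regular parametrisation of an element is a bijective $C^1$ map $\tilde P:[0,1]^2\to$ element (polynomial in $(u,v)$) whose Jacobian determinant does not vanish on $[0,1]^2$. A global regular in-plane parametrisation $\tilde\Pi$ consists of a regular polynomial parametrisation (of some fixed degree, in B\'ezier form) for each element such that the planar control points of adjacent elements coincide along the common edge. A piecewise parametric $3D$ function $\bar\Psi$ agrees with $\tilde\Pi$ if its restriction to each element is a map $[0,1]^2\to\mathbb R^3$ whose $(X,Y)$-coordinates equal the parametrisation of that element given by $\tilde\Pi$. Each patch is assumed to have continuous first-order partial derivatives. Two patches $\bar L,\bar R:[0,1]^2\to\mathbb R^3$ with $\bar L(1,v)=\bar R(0,v)$ for all $v$ join $G^1$-smoothly along the common edge if there exist scalar-valued functions $\breve l,\breve r,\breve c$ on $[0,1]$ such that for every $v\in[0,1]$: (i) $\bar L_u(1,v)\breve l(v)+\bar R_u(0,v)\breve r(v)+\bar L_v(1,v)\breve c(v)=0$; (ii) $\breve l(v)\breve r(v)<0$; (iii) $\langle\bar L_u(1,v),\bar L_v(1,v)\rangle\ne 0$. *)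

theory Defs
  imports "HOL-Analysis.Analysis"
begin

subsection \<open>Meshes of convex quadrilaterals\<close>

definition convex_quadrilateral :: "(real^2) set \<Rightarrow> bool" where
  "convex_quadrilateral Q \<longleftrightarrow>
     polytope Q \<and> aff_dim Q = 2 \<and> card {x. x extreme_point_of Q} = 4"

definition common_edge :: "(real^2) set \<Rightarrow> (real^2) set \<Rightarrow> (real^2) set \<Rightarrow> bool" where
  "common_edge e Q Q' \<longleftrightarrow> e edge_of Q \<and> e edge_of Q' \<and> Q \<inter> Q' = e"

definition common_vertex :: "real^2 \<Rightarrow> (real^2) set \<Rightarrow> (real^2) set \<Rightarrow> bool" where
  "common_vertex x Q Q' \<longleftrightarrow> x extreme_point_of Q \<and> x extreme_point_of Q' \<and> Q \<inter> Q' = {x}"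

definition quadrilateral_mesh :: "(real^2) set set \<Rightarrow> bool" where
  "quadrilateral_mesh M \<longleftrightarrow>
     finite M \<and> simply_connected (\<Union>M) \<and>
     (\<forall>Q\<in>M. convex_quadrilateral Q) \<and>
     (\<forall>Q\<in>M. \<forall>Q'\<in>M. Q \<noteq> Q' \<longrightarrow>
        interior Q \<inter> interior Q' = {} \<and>
        (Q \<inter> Q' = {} \<or> (\<exists>x. common_vertex x Q Q') \<or> (\<exists>e. common_edge e Q Q')))"

subsection \<open>Patches over the unit square\<close>

abbreviation unit_square :: "(real \<times> real) set" where
  "unit_square \<equiv> {0..1} \<times> {0..1}"

text \<open>Partial derivatives are taken within the closed parameter interval, hence are
  one-sided on the boundary of the square.\<close>

definition partial_u :: "(real \<times> real \<Rightarrow> 'a::real_normed_vector) \<Rightarrow> real \<times> real \<Rightarrow> 'a" where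
  "partial_u F p = vector_derivative (\<lambda>t. F (t, snd p)) (at (fst p) within {0..1})"

definition partial_v :: "(real \<times> real \<Rightarrow> 'a::real_normed_vector) \<Rightarrow> real \<times> real \<Rightarrow> 'a" where
  "partial_v F p = vector_derivative (\<lambda>t. F (fst p, t)) (at (snd p) within {0..1})"

definition C1_patch :: "(real \<times> real \<Rightarrow> 'a::real_normed_vector) \<Rightarrow> bool" where
  "C1_patch F \<longleftrightarrow>
     (\<forall>u\<in>{0..1}. \<forall>v\<in>{0..1}.
        (\<lambda>t. F (t, v)) differentiable (at u within {0..1}) \<and>
        (\<lambda>t. F (u, t)) differentiable (at v within {0..1})) \<and>
     continuous_on unit_square (partial_u F) \<and>
     continuous_on unit_square (partial_v F)"

definition planar_cross :: "real^2 \<Rightarrow> real^2 \<Rightarrow> real" where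
  "planar_cross a b = a $ 1 * b $ 2 - a $ 2 * b $ 1"

definition xy_part :: "real^3 \<Rightarrow> real^2" where
  "xy_part P = vector [P $ 1, P $ 2]"

definition z_part :: "real^3 \<Rightarrow> real" where
  "z_part P = P $ 3"

subsection \<open>In-plane parametrisations\<close>

definition regular_parametrisation :: "(real \<times> real \<Rightarrow> real^2) \<Rightarrow> (real^2) set \<Rightarrow> bool" where
  "regular_parametrisation F Q \<longleftrightarrow>
     bij_betw F unit_square Q \<and> C1_patch F \<and>
     (\<forall>p\<in>unit_square. planar_cross (partial_u F p) (partial_v F p) \<noteq> 0)"

definition bezier_patch :: "nat \<Rightarrow> (nat \<times> nat \<Rightarrow> real^2) \<Rightarrow> real \<times> real \<Rightarrow> real^2" where
  "bezier_patch n net p =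
     (\<Sum>i\<le>n. \<Sum>j\<le>n. (Bernstein n i (fst p) * Bernstein n j (snd p)) *\<^sub>R net (i, j))"

text \<open>The eight symmetries of the parameter square: an optional swap of the two coordinates,
  followed by optional reflections \<open>x \<mapsto> m - x\<close> of each of them. With \<open>m = 1\<close> they act on
  parameters and with \<open>m = n\<close> on indices of control points of degree \<open>n\<close>. The two actions are
  compatible: \<open>bezier_patch n net (reorient s 1 p) = bezier_patch n (net \<circ> reorient s n) p\<close>.
  They are needed since the sides of two elements that parametrise their common edge
  can be any of the four sides of the square, traversed in either direction.\<close>

fun reorient :: "bool \<times> bool \<times> bool \<Rightarrow> 'a::minus \<Rightarrow> 'a \<times> 'a \<Rightarrow> 'a \<times> 'a" where
  "reorient (sw, fu, fv) m (a, b) =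
     (let x = (if sw then b else a); y = (if sw then a else b)
      in (if fu then m - x else x, if fv then m - y else y))"

definition global_regular_parametrisation ::
    "(real^2) set set \<Rightarrow> ((real^2) set \<Rightarrow> real \<times> real \<Rightarrow> real^2) \<Rightarrow> bool" where
  "global_regular_parametrisation M \<Phi> \<longleftrightarrow>
     (\<exists>n net.
        (\<forall>Q\<in>M. regular_parametrisation (\<Phi> Q) Q \<and>
                (\<forall>p\<in>unit_square. \<Phi> Q p = bezier_patch n (net Q) p)) \<and>
        (\<forall>Q\<in>M. \<forall>Q'\<in>M. \<forall>e. Q \<noteq> Q' \<and> common_edge e Q Q' \<longrightarrow>
           (\<exists>s s'. (\<Phi> Q \<circ> reorient s 1) ` ({1} \<times> {0..1}) = e \<and>
                   (\<Phi> Q' \<circ> reorient s' 1) ` ({0} \<times> {0..1}) = e \<and>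
                   (\<forall>j\<le>n. net Q (reorient s n (n, j)) = net Q' (reorient s' n (0, j))))))"

subsection \<open>Piecewise parametric 3D functions and smooth joins\<close>

definition agrees_with ::
    "(real^2) set set \<Rightarrow> ((real^2) set \<Rightarrow> real \<times> real \<Rightarrow> real^3) \<Rightarrow>
     ((real^2) set \<Rightarrow> real \<times> real \<Rightarrow> real^2) \<Rightarrow> bool" where
  "agrees_with M \<Psi> \<Phi> \<longleftrightarrow>
     (\<forall>Q\<in>M. C1_patch (\<Psi> Q) \<and> (\<forall>p\<in>unit_square. xy_part (\<Psi> Q p) = \<Phi> Q p))"

text \<open>Applied to patches with \<open>L (1, v) = R (0, v)\<close> for all \<open>v\<close> in the unit interval.\<close>

definition G1_join :: "(real \<times> real \<Rightarrow> real^3) \<Rightarrow> (real \<times> real \<Rightarrow> real^3) \<Rightarrow> bool" where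
  "G1_join L R \<longleftrightarrow>
     (\<exists>l r c :: real \<Rightarrow> real. \<forall>v\<in>{0..1}.
        l v *\<^sub>R partial_u L (1, v) + r v *\<^sub>R partial_u R (0, v) + c v *\<^sub>R partial_v L (1, v) = 0 \<and>
        l v * r v < 0 \<and>
        cross3 (partial_u L (1, v)) (partial_v L (1, v)) \<noteq> 0)"

end

theory Submission
  imports Defs
begin

text \<open>
  The theorem is a statement about each point of the common edge separately. At such a point
  let \<open>a\<close> and \<open>b\<close> be the planar cross-boundary derivatives of the left and the right patch and
  \<open>t\<close> their common planar tangent along the edge. Regularity gives \<open>\<langle>a, t\<rangle> \<noteq> 0\<close>, so \<open>a\<close> and \<open>t\<close> span
  the plane and the planar relations between \<open>a\<close>, \<open>b\<close>, \<open>t\<close> form a line. Cramer's rule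
  \<open>\<langle>b, t\<rangle> a - \<langle>a, t\<rangle> b + \<langle>a, b\<rangle> t = 0\<close> says that \<open>(l, r, c)\<close> spans it. The blending coefficients of
  any smooth join are therefore a nonzero multiple of \<open>(l, r, c)\<close>, and the third coordinate of
  their relation is the stated equation up to that factor
  (\<open>exists_blending_iff_height_relation\<close>).

  For the converse, \<open>(l, r, c)\<close> itself serves as the blending triple, and what has to be shown is
  \<open>l r < 0\<close>, that is, \<open>\<langle>a, t\<rangle>\<close> and \<open>\<langle>b, t\<rangle>\<close> have the same sign
  (\<open>cross_boundary_derivatives_same_sign\<close>). This is where the geometry of the mesh enters: two
  convex elements with disjoint interiors lie on opposite sides of a line, the left patch runs
  towards that line and the right patch runs away from it, so \<open>a\<close> and \<open>b\<close> point to the same side,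
  while \<open>t\<close> is parallel to it.

  The hypotheses concern the given parametrisations, whereas the conclusion concerns the patches
  after a symmetry of the square; hence regularity has to be transported along \<open>reorient\<close>.
\<close>

section \<open>Partial derivatives on the unit square\<close>

lemma has_partial_u:
  assumes "C1_patch F" "u \<in> {0..1}" "v \<in> {0..1}"
  shows "((\<lambda>t. F (t, v)) has_vector_derivative partial_u F (u, v)) (at u within {0..1})"
  using assms unfolding C1_patch_def partial_u_def by (simp add: vector_derivative_works)

lemma has_partial_v:
  assumes "C1_patch F" "u \<in> {0..1}" "v \<in> {0..1}"
  shows "((\<lambda>t. F (u, t)) has_vector_derivative partial_v F (u, v)) (at v within {0..1})"
  using assms unfolding C1_patch_def partial_v_def by (simp add: vector_derivative_works)

lemma partial_u_eqI:
  assumes "((\<lambda>t. F (t, v)) has_vector_derivative d) (at u within {0..1})" "u \<in> {0..1}"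
  shows "partial_u F (u, v) = d"
  unfolding partial_u_def
  using vector_derivative_within_cbox[of 0 1 u "\<lambda>t. F (t, v)" d] assms by simp

lemma partial_v_eqI:
  assumes "((\<lambda>t. F (u, t)) has_vector_derivative d) (at v within {0..1})" "v \<in> {0..1}"
  shows "partial_v F (u, v) = d"
  unfolding partial_v_def
  using vector_derivative_within_cbox[of 0 1 v "\<lambda>t. F (u, t)" d] assms by simp

lemma C1_patchI:
  assumes "\<And>u v. u \<in> {0..1} \<Longrightarrow> v \<in> {0..1} \<Longrightarrow>
      ((\<lambda>t. F (t, v)) has_vector_derivative Fu (u, v)) (at u within {0..1})"
    and "\<And>u v. u \<in> {0..1} \<Longrightarrow> v \<in> {0..1} \<Longrightarrow>
      ((\<lambda>t. F (u, t)) has_vector_derivative Fv (u, v)) (at v within {0..1})"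
    and "continuous_on unit_square Fu" "continuous_on unit_square Fv"
  shows "C1_patch F"
proof -
  have "continuous_on unit_square (partial_u F)"
    using assms(3) by (rule continuous_on_eq) (auto simp: partial_u_eqI[OF assms(1)])
  moreover have "continuous_on unit_square (partial_v F)"
    using assms(4) by (rule continuous_on_eq) (auto simp: partial_v_eqI[OF assms(2)])
  ultimately show ?thesis
    unfolding C1_patch_def using assms(1,2) by (blast intro: differentiableI_vector)
qed

lemma partial_u_cong:
  assumes "\<And>p. p \<in> unit_square \<Longrightarrow> F p = G p" "C1_patch G" "p \<in> unit_square"
  shows "partial_u F p = partial_u G p"
proof (cases p)
  case (Pair u v)
  have "((\<lambda>t. F (t, v)) has_vector_derivative partial_u G (u, v)) (at u within {0..1})"
    by (rule has_vector_derivative_transform[OF _ _ has_partial_u[OF assms(2)]])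
      (use assms Pair in auto)
  thus ?thesis using partial_u_eqI assms(3) Pair by fastforce
qed

lemma partial_v_cong:
  assumes "\<And>p. p \<in> unit_square \<Longrightarrow> F p = G p" "C1_patch G" "p \<in> unit_square"
  shows "partial_v F p = partial_v G p"
proof (cases p)
  case (Pair u v)
  have "((\<lambda>t. F (u, t)) has_vector_derivative partial_v G (u, v)) (at v within {0..1})"
    by (rule has_vector_derivative_transform[OF _ _ has_partial_v[OF assms(2)]])
      (use assms Pair in auto)
  thus ?thesis using partial_v_eqI assms(3) Pair by fastforce
qed

lemma bounded_linear_partials:
  assumes "bounded_linear h" "C1_patch F" "u \<in> {0..1}" "v \<in> {0..1}"
  shows partial_u_bounded_linear: "partial_u (h \<circ> F) (u, v) = h (partial_u F (u, v))"
    and partial_v_bounded_linear: "partial_v (h \<circ> F) (u, v) = h (partial_v F (u, v))"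
  using bounded_linear.has_vector_derivative[OF assms(1) has_partial_u[OF assms(2-4)]]
    bounded_linear.has_vector_derivative[OF assms(1) has_partial_v[OF assms(2-4)]] assms
  by (simp_all add: partial_u_eqI partial_v_eqI)

lemma bounded_linear_xy_part: "bounded_linear xy_part"
  by (rule linear_conv_bounded_linear[THEN iffD1], rule linearI)
    (simp_all add: xy_part_def vec_eq_iff forall_2)

lemma bounded_linear_z_part: "bounded_linear z_part"
  unfolding z_part_def by (rule bounded_linear_vec_nth)

section \<open>Symmetries of the parameter square\<close>

lemma has_vector_derivative_reflect:
  fixes f :: "real \<Rightarrow> 'a::real_normed_vector"
  assumes "(f has_vector_derivative d) (at (1 - t) within {0..1})"
  shows "((\<lambda>x. f (1 - x)) has_vector_derivative - d) (at t within {0..1})"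
proof -
  have "(f \<circ> (\<lambda>x. 1 - x) has_vector_derivative (- 1) *\<^sub>R d) (at t within {0..1})"
  proof (rule vector_diff_chain_within)
    show "((\<lambda>x. 1 - x) has_vector_derivative - 1) (at t within {0..1::real})"
      by (auto intro!: derivative_eq_intros)
    have "(\<lambda>x. 1 - x) ` {0..1} = {0..1::real}" by simp
    thus "(f has_vector_derivative d) (at (1 - t) within (\<lambda>x. 1 - x) ` {0..1})"
      using assms by simp
  qed
  thus ?thesis by (simp add: o_def)
qed

lemma reorient_in_unit_square:
  "p \<in> unit_square \<Longrightarrow> reorient s 1 p \<in> unit_square"
  by (cases s; cases p) (auto simp: Let_def)

lemma bij_betw_reorient: "bij_betw (reorient s (1::real)) unit_square unit_square"
proof -
  obtain sw fu fv where s: "s = (sw, fu, fv)" by (cases s)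
  \<comment> \<open>A swap followed by reflections is undone by the same swap followed by the
      interchanged reflections.\<close>
  let ?s' = "if sw then (sw, fv, fu) else s"
  show ?thesis
    by (rule bij_betw_byWitness[where f' = "reorient ?s' 1"])
      (auto simp: s Let_def)
qed

lemma continuous_on_reorient: "continuous_on S (reorient s (1::real))"
proof -
  obtain sw fu fv where s: "s = (sw, fu, fv)" by (cases s)
  have "reorient s (1::real) = (\<lambda>p. let x = (if sw then snd p else fst p);
      y = (if sw then fst p else snd p) in (if fu then 1 - x else x, if fv then 1 - y else y))"
    by (auto simp: s fun_eq_iff)
  thus ?thesis
    by (cases sw; cases fu; cases fv) (auto simp: Let_def intro!: continuous_intros)
qed

text \<open>The chain rule for a symmetry of the square: it permutes the two partial derivatives and
  changes their signs, the signs being those of the reflections that act on the coordinate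
  in question after the swap.\<close>

lemma has_partials_reorient:
  fixes F :: "real \<times> real \<Rightarrow> 'a::real_normed_vector" and sw fu fv :: bool
  assumes "C1_patch F" "u \<in> {0..1}" "v \<in> {0..1}"
  defines "G \<equiv> F \<circ> reorient (sw, fu, fv) 1" and "q \<equiv> reorient (sw, fu, fv) 1 (u, v)"
  defines "\<sigma> \<equiv> if fu then - 1 else 1" and "\<tau> \<equiv> if fv then - 1 else 1"
  shows has_partial_u_reorient: "((\<lambda>t. G (t, v)) has_vector_derivative
      (if sw then \<tau> *\<^sub>R partial_v F q else \<sigma> *\<^sub>R partial_u F q)) (at u within {0..1})"
    and has_partial_v_reorient: "((\<lambda>t. G (u, t)) has_vector_derivative
      (if sw then \<sigma> *\<^sub>R partial_u F q else \<tau> *\<^sub>R partial_v F q)) (at v within {0..1})"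
proof -
  have refl: "1 - x \<in> {0..1}" if "x \<in> {0..1}" for x :: real using that by auto
  note [simp] = assms(2-3)[simplified]
    and F = has_partial_u[OF assms(1)] has_partial_v[OF assms(1)]
  note F_reflected = F[THEN has_vector_derivative_reflect]
  show "((\<lambda>t. G (t, v)) has_vector_derivative
      (if sw then \<tau> *\<^sub>R partial_v F q else \<sigma> *\<^sub>R partial_u F q)) (at u within {0..1})"
    unfolding G_def q_def \<sigma>_def \<tau>_def
    by (cases sw; cases fu; cases fv)
      (simp_all add: o_def Let_def F F_reflected)
  show "((\<lambda>t. G (u, t)) has_vector_derivative
      (if sw then \<sigma> *\<^sub>R partial_u F q else \<tau> *\<^sub>R partial_v F q)) (at v within {0..1})"
    unfolding G_def q_def \<sigma>_def \<tau>_def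
    by (cases sw; cases fu; cases fv)
      (simp_all add: o_def Let_def F F_reflected)
qed

lemma C1_patch_reorient:
  assumes "C1_patch F"
  shows "C1_patch (F \<circ> reorient s 1)"
proof -
  obtain sw fu fv where s: "s = (sw, fu, fv)" by (cases s)
  have cont: "continuous_on unit_square (\<lambda>p. H (reorient s 1 p))"
    if "continuous_on unit_square H" for H :: "real \<times> real \<Rightarrow> 'a"
    using continuous_on_compose2[OF that continuous_on_reorient] reorient_in_unit_square by blast
  have "continuous_on unit_square (partial_u F)" "continuous_on unit_square (partial_v F)"
    using assms by (auto simp: C1_patch_def)
  note cont_partials = this[THEN cont, unfolded s]
  show ?thesis
    unfolding s
    by (rule C1_patchI[OF has_partial_u_reorient[OF assms] has_partial_v_reorient[OF assms]])
      (use cont_partials in \<open>cases sw; cases fu; cases fv;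
        auto intro!: continuous_intros simp del: reorient.simps\<close>)+
qed

lemma planar_cross_scaleR:
  "planar_cross (x *\<^sub>R a) (y *\<^sub>R b) = x * y * planar_cross a b"
  by (simp add: planar_cross_def algebra_simps)

lemma planar_cross_commute: "planar_cross b a = - planar_cross a b"
  by (simp add: planar_cross_def)

lemma regular_parametrisation_reorient:
  assumes "regular_parametrisation F Q"
  shows "regular_parametrisation (F \<circ> reorient s 1) Q"
  unfolding regular_parametrisation_def
proof (intro conjI ballI)
  have F: "bij_betw F unit_square Q" "C1_patch F"
      "\<And>p. p \<in> unit_square \<Longrightarrow> planar_cross (partial_u F p) (partial_v F p) \<noteq> 0"
    using assms by (auto simp: regular_parametrisation_def)
  show "bij_betw (F \<circ> reorient s 1) unit_square Q"
    using bij_betw_trans[OF bij_betw_reorient F(1)] .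
  show "C1_patch (F \<circ> reorient s 1)"
    by (rule C1_patch_reorient[OF F(2)])
  obtain sw fu fv where s: "s = (sw, fu, fv)" by (cases s)
  fix p :: "real \<times> real"
  assume p: "p \<in> unit_square"
  obtain u v where uv: "p = (u, v)" "u \<in> {0..1}" "v \<in> {0..1}" using p by auto
  define q where "q = reorient (sw, fu, fv) 1 (u, v)"
  have "planar_cross (partial_u F q) (partial_v F q) \<noteq> 0"
    unfolding q_def using F(3) reorient_in_unit_square p uv by blast
  thus "planar_cross (partial_u (F \<circ> reorient s 1) p) (partial_v (F \<circ> reorient s 1) p) \<noteq> 0"
    unfolding s uv(1) partial_u_eqI[OF has_partial_u_reorient[OF F(2) uv(2,3)] uv(2)]
      partial_v_eqI[OF has_partial_v_reorient[OF F(2) uv(2,3)] uv(3)]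
      q_def[symmetric]
    by (simp add: planar_cross_scaleR planar_cross_commute[of "partial_v F q"])
qed

lemma regular_parametrisation_cong:
  assumes "regular_parametrisation F Q" "\<And>p. p \<in> unit_square \<Longrightarrow> G p = F p"
  shows "regular_parametrisation G Q"
proof -
  have F: "C1_patch F" using assms(1) by (simp add: regular_parametrisation_def)
  note eqs = partial_u_cong[OF assms(2) F] partial_v_cong[OF assms(2) F]
  have "C1_patch G"
  proof (rule C1_patchI[where Fu = "partial_u F" and Fv = "partial_v F"])
    fix u v :: real
    assume uv: "u \<in> {0..1}" "v \<in> {0..1}"
    show "((\<lambda>t. G (t, v)) has_vector_derivative partial_u F (u, v)) (at u within {0..1})"
      by (rule has_vector_derivative_transform[OF _ _ has_partial_u[OF F]])
        (use uv assms(2) in auto)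
    show "((\<lambda>t. G (u, t)) has_vector_derivative partial_v F (u, v)) (at v within {0..1})"
      by (rule has_vector_derivative_transform[OF _ _ has_partial_v[OF F]])
        (use uv assms(2) in auto)
  qed (use F in \<open>auto simp: C1_patch_def\<close>)
  moreover have "bij_betw G unit_square Q"
    using assms bij_betw_cong[of unit_square G F Q] by (simp add: regular_parametrisation_def)
  ultimately show ?thesis
    using assms(1) eqs unfolding regular_parametrisation_def by (metis (no_types, lifting))
qed

section \<open>Adjacent elements lie on opposite sides of a line\<close>

lemma convex_quadrilateral_closure_interior:
  assumes "convex_quadrilateral Q"
  shows "convex Q" "interior Q \<noteq> {}" "closure (interior Q) = Q"
proof -
  have Q: "polytope Q" "aff_dim Q = 2" using assms by (auto simp: convex_quadrilateral_def)
  show "convex Q" using Q(1) by (rule polytope_imp_convex)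
  show ne: "interior Q \<noteq> {}"
  proof -
    have "affine hull Q = UNIV"
      using Q(2) by (simp add: aff_dim_eq_full[symmetric])
    hence "interior Q = rel_interior Q" by (simp add: rel_interior_interior)
    moreover have "Q \<noteq> {}" using Q(2) by auto
    ultimately show ?thesis by (simp add: rel_interior_eq_empty[OF \<open>convex Q\<close>])
  qed
  show "closure (interior Q) = Q"
    using convex_closure_interior[OF \<open>convex Q\<close> ne] polytope_imp_closed[OF Q(1)] by simp
qed

lemma separating_line:
  assumes Q: "convex_quadrilateral Q" and Q': "convex_quadrilateral Q'"
    and disj: "interior Q \<inter> interior Q' = {}"
  obtains n k where "n \<noteq> 0" "\<And>x. x \<in> Q \<Longrightarrow> n \<bullet> x \<le> k" "\<And>x. x \<in> Q' \<Longrightarrow> k \<le> n \<bullet> x"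
proof -
  note QC = convex_quadrilateral_closure_interior[OF Q]
    and QC' = convex_quadrilateral_closure_interior[OF Q']
  obtain n k where n: "n \<noteq> 0" and le: "\<forall>x\<in>interior Q. n \<bullet> x \<le> k"
    and ge: "\<forall>x\<in>interior Q'. k \<le> n \<bullet> x"
    using separating_hyperplane_sets[OF convex_interior[OF QC(1)] convex_interior[OF QC'(1)]
        QC(2) QC'(2) disj] by blast
  have "closure (interior Q) \<subseteq> {x. n \<bullet> x \<le> k}"
    by (rule closure_minimal) (use le in \<open>auto simp: closed_halfspace_le\<close>)
  moreover have "closure (interior Q') \<subseteq> {x. n \<bullet> x \<ge> k}"
    by (rule closure_minimal) (use ge in \<open>auto simp: closed_halfspace_ge\<close>)
  ultimately show ?thesis
    unfolding QC(3) QC'(3) by (intro that[OF n]) auto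
qed

lemma derivative_nonneg_if_difference_quotient_nonneg:
  fixes f :: "real \<Rightarrow> real"
  assumes "(f has_vector_derivative d) (at x within {0..1})" "x \<in> {0..1}"
    and "\<And>y. y \<in> {0..1} \<Longrightarrow> 0 \<le> (f y - f x) / (y - x)"
  shows "0 \<le> d"
proof (rule tendsto_lowerbound)
  show "((\<lambda>y. (f y - f x) / (y - x)) \<longlongrightarrow> d) (at x within {0..1})"
    using assms(1)
    by (simp add: has_real_derivative_iff_has_vector_derivative[symmetric] has_field_derivative_iff)
  show "\<forall>\<^sub>F y in at x within {0..1}. 0 \<le> (f y - f x) / (y - x)"
    using assms(3) by (auto simp: eventually_at_filter)
  show "at x within {0..1} \<noteq> bot"
    using assms(2) by (simp add: trivial_limit_within islimpt_Icc)
qed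

text \<open>In the plane the normals of \<open>t\<close> are the multiples of \<open>(t\<^sub>2, - t\<^sub>1)\<close>, and the inner product
  with this vector is \<open>\<langle>_, t\<rangle>\<close>. Hence lying on the same side of the line along \<open>t\<close> is a matter
  of the sign of \<open>\<langle>_, t\<rangle>\<close>.\<close>

lemma planar_cross_same_side:
  fixes n t a b :: "real^2"
  assumes "n \<noteq> 0" "n \<bullet> t = 0" "0 \<le> n \<bullet> a" "0 \<le> n \<bullet> b"
    and "planar_cross a t \<noteq> 0" "planar_cross b t \<noteq> 0"
  shows "0 < planar_cross a t * planar_cross b t"
proof -
  have t: "t \<noteq> 0" using assms(5) by (auto simp: planar_cross_def)
  have nt: "n $ 1 * t $ 1 + n $ 2 * t $ 2 = 0"
    using assms(2) by (simp add: inner_vec_def sum_2)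
  \<comment> \<open>the coefficient of \<open>n\<close> along the normal \<open>(t\<^sub>2, - t\<^sub>1)\<close>, by orthogonal projection\<close>
  define \<mu> where "\<mu> = (n $ 1 * t $ 2 - n $ 2 * t $ 1) / ((t $ 1)\<^sup>2 + (t $ 2)\<^sup>2)"
  have tt: "(t $ 1)\<^sup>2 + (t $ 2)\<^sup>2 \<noteq> 0"
    using t by (simp add: vec_eq_iff forall_2 sum_power2_eq_zero_iff)
  have n1: "n $ 1 = \<mu> * t $ 2"
  proof -
    have "n $ 1 * ((t $ 1)\<^sup>2 + (t $ 2)\<^sup>2) = (n $ 1 * t $ 2 - n $ 2 * t $ 1) * t $ 2"
      using nt by algebra
    thus ?thesis using tt by (simp add: \<mu>_def field_simps)
  qed
  have n2: "n $ 2 = - \<mu> * t $ 1"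
  proof -
    have "n $ 2 * ((t $ 1)\<^sup>2 + (t $ 2)\<^sup>2) = - (n $ 1 * t $ 2 - n $ 2 * t $ 1) * t $ 1"
      using nt by algebra
    thus ?thesis using tt by (simp add: \<mu>_def field_simps)
  qed
  have inner: "n \<bullet> x = \<mu> * planar_cross x t" for x
    by (simp add: inner_vec_def sum_2 n1 n2 planar_cross_def algebra_simps)
  have "\<mu> \<noteq> 0" using n1 n2 assms(1) by (auto simp: vec_eq_iff forall_2)
  with assms(3-6) show ?thesis
    by (auto simp: inner zero_le_mult_iff zero_less_mult_iff)
qed

text \<open>Let \<open>n \<bullet> x = k\<close> separate the two elements. Then \<open>n \<bullet> F\<close> is at most \<open>k\<close> and \<open>n \<bullet> G\<close> is at least
  \<open>k\<close>, and on the common boundary curve, which lies in both elements, both equal \<open>k\<close>.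
  Their one-sided derivatives there give \<open>0 \<le> n \<bullet> F\<^sub>u\<close>, \<open>0 \<le> n \<bullet> G\<^sub>u\<close> and \<open>n \<bullet> F\<^sub>v = 0\<close>.\<close>

lemma cross_boundary_derivatives_same_sign:
  assumes F: "regular_parametrisation F Q" and G: "regular_parametrisation G Q'"
    and quads: "convex_quadrilateral Q" "convex_quadrilateral Q'"
    and disj: "interior Q \<inter> interior Q' = {}"
    and join: "\<And>v. v \<in> {0..1} \<Longrightarrow> F (1, v) = G (0, v)"
    and v: "v \<in> {0..1}"
  shows "0 < planar_cross (partial_u F (1, v)) (partial_v F (1, v)) *
             planar_cross (partial_u G (0, v)) (partial_v F (1, v))"
proof -
  obtain n k where n: "n \<noteq> 0" "\<And>x. x \<in> Q \<Longrightarrow> n \<bullet> x \<le> k" "\<And>x. x \<in> Q' \<Longrightarrow> k \<le> n \<bullet> x"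
    using separating_line[OF quads disj] by blast
  have C1: "C1_patch F" "C1_patch G"
    using F G by (auto simp: regular_parametrisation_def)
  have inQ: "F (x, y) \<in> Q" "G (x, y) \<in> Q'" if "x \<in> {0..1}" "y \<in> {0..1}" for x y
    using F G that by (auto simp: regular_parametrisation_def dest!: bij_betw_imp_surj_on)
  have edge: "n \<bullet> F (1, y) = k" "n \<bullet> G (0, y) = k" if "y \<in> {0..1}" for y
    using n(2)[OF inQ(1)[of 1 y]] n(3)[OF inQ(2)[of 0 y]] join[OF that] that by auto
  note inner = bounded_linear.has_vector_derivative[OF bounded_linear_inner_right[of n]]

  have "0 \<le> n \<bullet> partial_u F (1, v)"
  proof (rule derivative_nonneg_if_difference_quotient_nonneg)
    show "((\<lambda>t. n \<bullet> F (t, v)) has_vector_derivative n \<bullet> partial_u F (1, v)) (at 1 within {0..1})"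
      using inner[OF has_partial_u[OF C1(1)]] v by simp
    show "0 \<le> (n \<bullet> F (y, v) - n \<bullet> F (1, v)) / (y - 1)" if "y \<in> {0..1}" for y
      using n(2)[OF inQ(1)[OF that v]] edge(1)[OF v] that by (auto intro: divide_nonpos_nonpos)
  qed simp
  moreover have "0 \<le> n \<bullet> partial_u G (0, v)"
  proof (rule derivative_nonneg_if_difference_quotient_nonneg)
    show "((\<lambda>t. n \<bullet> G (t, v)) has_vector_derivative n \<bullet> partial_u G (0, v)) (at 0 within {0..1})"
      using inner[OF has_partial_u[OF C1(2)]] v by simp
    show "0 \<le> (n \<bullet> G (y, v) - n \<bullet> G (0, v)) / (y - 0)" if "y \<in> {0..1}" for y
      using n(3)[OF inQ(2)[OF that v]] edge(2)[OF v] that by (auto intro: divide_nonneg_nonneg)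
  qed simp
  moreover have "n \<bullet> partial_v F (1, v) = 0"
  proof -
    have "((\<lambda>t. n \<bullet> F (1, t)) has_vector_derivative n \<bullet> partial_v F (1, v)) (at v within {0..1})"
      using inner[OF has_partial_v[OF C1(1)]] v by simp
    moreover have "((\<lambda>t. n \<bullet> F (1, t)) has_vector_derivative 0) (at v within {0..1})"
      by (rule has_vector_derivative_transform[OF v _ has_vector_derivative_const[of k]])
        (simp add: edge)
    ultimately show ?thesis
      using vector_derivative_unique_within_closed_interval[of 0 1 v] v by simp
  qed
  moreover have "partial_v F (1, v) = partial_v G (0, v)"
  proof (rule partial_v_eqI[OF _ v])
    show "((\<lambda>t. F (1, t)) has_vector_derivative partial_v G (0, v)) (at v within {0..1})"
      by (rule has_vector_derivative_transform[OF v _ has_partial_v[OF C1(2)]])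
        (use join v in auto)
  qed
  moreover have "planar_cross (partial_u F (1, v)) (partial_v F (1, v)) \<noteq> 0"
      "planar_cross (partial_u G (0, v)) (partial_v G (0, v)) \<noteq> 0"
    using F G v by (auto simp: regular_parametrisation_def)
  ultimately show ?thesis
    using planar_cross_same_side n(1) by metis
qed

section \<open>Blending coefficients\<close>

text \<open>Taking \<open>\<langle>_, t\<rangle>\<close> and \<open>\<langle>a, _\<rangle>\<close> of a planar relation \<open>l a + r b + c t = 0\<close> leaves two terms each
  and determines \<open>l\<close> and \<open>c\<close> from \<open>r\<close>; so the relation is \<open>- r / \<langle>a, t\<rangle>\<close> times Cramer's relation.
  Its third coordinate then carries the same factor, which is nonzero because \<open>l r < 0\<close>.
  The sign hypothesis is what makes Cramer's relation itself an admissible choice.\<close>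

lemma exists_blending_iff_height_relation:
  fixes A B T :: "real^3"
  defines "a \<equiv> xy_part A" and "b \<equiv> xy_part B" and "t \<equiv> xy_part T"
  assumes side: "0 < planar_cross a t * planar_cross b t"
  shows "(\<exists>l r c. l *\<^sub>R A + r *\<^sub>R B + c *\<^sub>R T = 0 \<and> l * r < 0 \<and> cross3 A T \<noteq> 0) \<longleftrightarrow>
    z_part A * planar_cross b t + z_part B * (- planar_cross a t) + z_part T * planar_cross a b = 0"
    (is "?G1 \<longleftrightarrow> ?H")
proof
  have components: "l *\<^sub>R A + r *\<^sub>R B + c *\<^sub>R T = 0 \<longleftrightarrow>
      l * A $ 1 + r * B $ 1 + c * T $ 1 = 0 \<and>
      l * A $ 2 + r * B $ 2 + c * T $ 2 = 0 \<and>
      l * A $ 3 + r * B $ 3 + c * T $ 3 = 0" for l r c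
    by (simp add: vec_eq_iff forall_3)
  have at: "planar_cross a t \<noteq> 0" using side by auto
  note cross = planar_cross_def a_def b_def t_def xy_part_def z_part_def
  {
    assume ?G1
    then obtain l r c where rel: "l *\<^sub>R A + r *\<^sub>R B + c *\<^sub>R T = 0" and "l * r < 0" by blast
    note rel = rel[unfolded components]
    have l: "l * planar_cross a t = - r * planar_cross b t"
      using rel by (simp add: cross) algebra
    have c: "c * planar_cross a t = - r * planar_cross a b"
      using rel by (simp add: cross) algebra
    have z: "l * z_part A + r * z_part B + c * z_part T = 0"
      using rel by (simp add: z_part_def)
    have "r * (z_part A * planar_cross b t + z_part B * (- planar_cross a t) +
        z_part T * planar_cross a b) = 0"
      using l c z by algebra
    with \<open>l * r < 0\<close> show ?H by auto
  next
    assume ?H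
    hence "planar_cross b t *\<^sub>R A + (- planar_cross a t) *\<^sub>R B + planar_cross a b *\<^sub>R T = 0"
      unfolding components by (simp add: cross algebra_simps)
    moreover have "planar_cross b t * (- planar_cross a t) < 0"
      using side by (simp add: mult.commute)
    moreover have "cross3 A T \<noteq> 0"
    proof
      assume "cross3 A T = 0"
      hence "cross3 A T $ 3 = 0" by simp
      with at show False by (simp add: cross3_def cross)
    qed
    ultimately show ?G1 by blast
  }
qed

text \<open>No continuity is asked of the blending functions, so they can be chosen point by point.\<close>

lemma G1_join_pointwise:
  "G1_join L R \<longleftrightarrow> (\<forall>v\<in>{0..1}. \<exists>l r c.
     l *\<^sub>R partial_u L (1, v) + r *\<^sub>R partial_u R (0, v) + c *\<^sub>R partial_v L (1, v) = 0 \<and>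
     l * r < 0 \<and> cross3 (partial_u L (1, v)) (partial_v L (1, v)) \<noteq> 0)"
  unfolding G1_join_def bchoice_iff[symmetric] by metis

section \<open>Smooth joins across a mesh edge\<close>

theorem theorem3:
  fixes M :: "(real^2) set set"
    and \<Phi> :: "(real^2) set \<Rightarrow> real \<times> real \<Rightarrow> real^2"
    and \<Psi> :: "(real^2) set \<Rightarrow> real \<times> real \<Rightarrow> real^3"
    and Q\<^sub>L Q\<^sub>R e :: "(real^2) set"
    and s\<^sub>L s\<^sub>R :: "bool \<times> bool \<times> bool"
    and L R :: "real \<times> real \<Rightarrow> real^3"
    and l r c :: "real \<Rightarrow> real"
  assumes mesh: "quadrilateral_mesh M"
    and param: "global_regular_parametrisation M \<Phi>"
    and agrees: "agrees_with M \<Psi> \<Phi>"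
    and elements: "Q\<^sub>L \<in> M" "Q\<^sub>R \<in> M" "Q\<^sub>L \<noteq> Q\<^sub>R"
    and edge: "common_edge e Q\<^sub>L Q\<^sub>R"
    and edge_L: "(\<Phi> Q\<^sub>L \<circ> reorient s\<^sub>L 1) ` ({1} \<times> {0..1}) = e"
    and edge_R: "(\<Phi> Q\<^sub>R \<circ> reorient s\<^sub>R 1) ` ({0} \<times> {0..1}) = e"
    and L: "L = \<Psi> Q\<^sub>L \<circ> reorient s\<^sub>L 1"
    and R: "R = \<Psi> Q\<^sub>R \<circ> reorient s\<^sub>R 1"
    and join: "\<forall>v\<in>{0..1}. L (1, v) = R (0, v)"
    and c: "c = (\<lambda>v. planar_cross (partial_u (xy_part \<circ> L) (1, v)) (partial_u (xy_part \<circ> R) (0, v)))"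
    and l: "l = (\<lambda>v. planar_cross (partial_u (xy_part \<circ> R) (0, v)) (partial_v (xy_part \<circ> L) (1, v)))"
    and r: "r = (\<lambda>v. - planar_cross (partial_u (xy_part \<circ> L) (1, v)) (partial_v (xy_part \<circ> L) (1, v)))"
  shows "G1_join L R \<longleftrightarrow>
    (\<forall>v\<in>{0..1}. partial_u (z_part \<circ> L) (1, v) * l v
              + partial_u (z_part \<circ> R) (0, v) * r v
              + partial_v (z_part \<circ> L) (1, v) * c v = 0)"
proof -
  have quads: "convex_quadrilateral Q\<^sub>L" "convex_quadrilateral Q\<^sub>R"
    and disj: "interior Q\<^sub>L \<inter> interior Q\<^sub>R = {}"
    using mesh elements by (auto simp: quadrilateral_mesh_def)
  have planar: "regular_parametrisation (xy_part \<circ> (\<Psi> Q \<circ> reorient s 1)) Q"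
    and spatial: "C1_patch (\<Psi> Q \<circ> reorient s 1)" if "Q \<in> M" for Q s
  proof -
    have "regular_parametrisation (\<Phi> Q) Q"
      using param that by (auto simp: global_regular_parametrisation_def)
    hence "regular_parametrisation (xy_part \<circ> \<Psi> Q) Q"
      by (rule regular_parametrisation_cong) (use agrees that in \<open>auto simp: agrees_with_def\<close>)
    thus "regular_parametrisation (xy_part \<circ> (\<Psi> Q \<circ> reorient s 1)) Q"
      using regular_parametrisation_reorient by (metis comp_assoc)
    show "C1_patch (\<Psi> Q \<circ> reorient s 1)"
      using agrees that by (auto simp: agrees_with_def intro: C1_patch_reorient)
  qed
  have C1: "C1_patch L" "C1_patch R"
    unfolding L R using spatial elements by auto
  have reg: "regular_parametrisation (xy_part \<circ> L) Q\<^sub>L" "regular_parametrisation (xy_part \<circ> R) Q\<^sub>R"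
    unfolding L R using planar elements by auto
  show ?thesis
    unfolding G1_join_pointwise
  proof (rule ball_cong[OF refl])
    fix v :: real
    assume v: "v \<in> {0..1}"
    have "(xy_part \<circ> L) (1, w) = (xy_part \<circ> R) (0, w)" if "w \<in> {0..1}" for w
      using join that by simp
    note side = cross_boundary_derivatives_same_sign[OF reg quads disj this v]
    have one: "1 \<in> {0..1::real}" and zero: "0 \<in> {0..1::real}" by auto
    note components =
      partial_u_bounded_linear[OF _ C1(1) one v] partial_v_bounded_linear[OF _ C1(1) one v]
      partial_u_bounded_linear[OF _ C1(2) zero v]
    note xy = components[OF bounded_linear_xy_part] and z = components[OF bounded_linear_z_part]
    show "(\<exists>l r c. l *\<^sub>R partial_u L (1, v) + r *\<^sub>R partial_u R (0, v) + c *\<^sub>R partial_v L (1, v) = 0 \<and>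
        l * r < 0 \<and> cross3 (partial_u L (1, v)) (partial_v L (1, v)) \<noteq> 0) \<longleftrightarrow>
      partial_u (z_part \<circ> L) (1, v) * l v + partial_u (z_part \<circ> R) (0, v) * r v
        + partial_v (z_part \<circ> L) (1, v) * c v = 0"
      unfolding l r c xy z
      by (rule exists_blending_iff_height_relation) (use side in \<open>simp only: xy\<close>)
  qed
qed

end
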